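(* Let $\mathbb{F}$ be a field, let $\mathcal{A}$ be an $\mathbb{F}$-algebra, let $m,n\ge 1$, and let $f_1,\ldots,f_m\in\mathbb{F}\langle X_1,\ldots,X_n\rangle$ be $\mathcal{A}$-locally linearly dependent. If $\mathcal{A}$ does not satisfy a polynomial identity of degree $$\beta:=\sum_{j=1}^m \deg(f_j)+m-1,$$ then $f_1,\ldots,f_m$ are linearly dependent in $\mathbb{F}\langle X_1,\ldots,X_n\rangle$ over $\mathbb{F}$.
   Context: Algebras are associative and unital; $\mathbb{F}$ is an arbitrary field (any characteristic, finite or infinite). $\mathbb{F}\langle X_1,\ldots,X_n\rangle$ is the free associative unital $\mathbb{F}$-algebra (polynomials in noncommuting variables $X_1,\ldots,X_n$), and $\deg$ is the total degree, i.e. the maximal length of a word occurring with nonzero coefficient. For $p\in\mathbb{F}\langle X_1,\ldots,X_n\rangle$ and $a=(a_1,\ldots,a_n)\in\mathcal{A}^n$, $p(a)\in\mathcal{A}$ is the evaluation of $p$ at $X_i=a_i$ (the empty word evaluates to the unit of $\mathcal{A}$). Polynomials $f_1,\ldots,f_m$ are $\mathcal{A}$-locally linearly dependent if for every $a\in\mathcal{A}^n$ the elements $f_1(a),\ldots,f_m(a)$ of $\mathcal{A}$ are linearly dependent over $\mathbb{F}$, i.e. there are $\alpha_1,\ldots,\alpha_m\in\mathbb{F}$ (possibly depending on $a$), not all zero, with $\sum_j\alpha_j f_j(a)=0$. A polynomial identity of $\mathcal{A}$ is a nonzero polynomial $p$ in some finite number $N$ of noncommuting variables over $\mathbb{F}$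 ($N$ arbitrary, unrelated to $n$) such that $p(a)=0$ for all $a\in\mathcal{A}^N$. "$\mathcal{A}$ does not satisfy a polynomial identity of degree $\beta$" means that no polynomial identity of $\mathcal{A}$ has degree $\beta$. *)

theory Defs
  imports Complex_Main "HOL-Library.Poly_Mapping"
begin

text \<open>
  Words over the alphabet \<open>nat\<close> form the free monoid, written additively because \<open>Poly_Mapping\<close>
  expects an additive monoid of exponents.  With this instance, \<open>nat list \<Rightarrow>\<^sub>0 'f\<close> carries the
  convolution product and is the free associative unital algebra on \<open>X\<^sub>0, X\<^sub>1, \<dots>\<close>; a word
  \<open>[i\<^sub>1, \<dots>, i\<^sub>k]\<close> stands for the monomial \<open>X\<^sub>i\<^sub>1 \<cdots> X\<^sub>i\<^sub>k\<close>.
\<close>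

instantiation list :: (type) monoid_add
begin

definition zero_list :: "'a list" where "0 = []"

definition plus_list :: "'a list \<Rightarrow> 'a list \<Rightarrow> 'a list" where "xs + ys = xs @ ys"

instance
  by standard (simp_all add: zero_list_def plus_list_def)

end

type_synonym 'f ncpoly = "nat list \<Rightarrow>\<^sub>0 'f"

definition nc_scale :: "'f::field \<Rightarrow> 'f ncpoly \<Rightarrow> 'f ncpoly" where
  "nc_scale c p = Poly_Mapping.map (\<lambda>x. c * x) p"

text \<open>The free algebra on \<open>X\<^sub>1, \<dots>, X\<^sub>n\<close>; the index \<open>0\<close> is not used.\<close>

definition free_algebra :: "nat \<Rightarrow> 'f::field ncpoly set" where
  "free_algebra n = {p. \<forall>w \<in> Poly_Mapping.keys p. set w \<subseteq> {1..n}}"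

text \<open>The degree of the zero polynomial is set to \<open>0\<close>.\<close>

definition nc_deg :: "'f::field ncpoly \<Rightarrow> nat" where
  "nc_deg p = (if p = 0 then 0 else Max (length ` Poly_Mapping.keys p))"

text \<open>
  The sort \<open>{ring, monoid_mult}\<close> is that of associative unital rings in which, unlike in
  \<open>ring_1\<close>, \<open>0 = 1\<close> is not excluded, so the zero algebra is covered.
\<close>

locale assoc_algebra = vector_space scale
  for scale :: "'f::field \<Rightarrow> 'a::{ring, monoid_mult} \<Rightarrow> 'a" +
  assumes scale_mult_left: "scale c x * y = scale c (x * y)"
    and scale_mult_right: "x * scale c y = scale c (x * y)"

definition nc_eval ::
  "('f::field \<Rightarrow> 'a::{ring, monoid_mult} \<Rightarrow> 'a) \<Rightarrow> 'f ncpoly \<Rightarrow> (nat \<Rightarrow> 'a) \<Rightarrow> 'a" where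
  "nc_eval scale p a =
    (\<Sum>w \<in> Poly_Mapping.keys p. scale (Poly_Mapping.lookup p w) (prod_list (map a w)))"

text \<open>
  Dependence of the indexed family \<open>v 1, \<dots>, v m\<close>, so that a repeated entry makes it dependent
  (the library's \<open>dependent\<close> is about sets).
\<close>

definition lin_dependent ::
  "('f::field \<Rightarrow> 'v::ab_group_add \<Rightarrow> 'v) \<Rightarrow> nat \<Rightarrow> (nat \<Rightarrow> 'v) \<Rightarrow> bool" where
  "lin_dependent scale m v \<longleftrightarrow>
    (\<exists>\<alpha>. (\<exists>j\<in>{1..m}. \<alpha> j \<noteq> 0) \<and> (\<Sum>j = 1..m. scale (\<alpha> j) (v j)) = 0)"

text \<open>
  A point of \<open>A\<^sup>n\<close> is given by a function \<open>nat \<Rightarrow> 'a\<close>: an element of \<open>free_algebra n\<close> only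
  depends on the values at \<open>1, \<dots>, n\<close>.
\<close>

definition locally_lin_dependent ::
  "('f::field \<Rightarrow> 'a::{ring, monoid_mult} \<Rightarrow> 'a) \<Rightarrow> nat \<Rightarrow> (nat \<Rightarrow> 'f ncpoly) \<Rightarrow> bool" where
  "locally_lin_dependent scale m f \<longleftrightarrow>
    (\<forall>a. lin_dependent scale m (\<lambda>j. nc_eval scale (f j) a))"

definition polynomial_identity ::
  "('f::field \<Rightarrow> 'a::{ring, monoid_mult} \<Rightarrow> 'a) \<Rightarrow> 'f ncpoly \<Rightarrow> bool" where
  "polynomial_identity scale p \<longleftrightarrow>
    p \<noteq> 0 \<and> (\<exists>N. p \<in> free_algebra N) \<and> (\<forall>a. nc_eval scale p a = 0)"

end

theory Submission
  imports Defs "HOL-Library.Multiset"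
begin

text \<open>
  Local linear dependence is turned into a polynomial identity by the Capelli polynomial.  Let
  \<open>y = X\<^sub>n\<^sub>+\<^sub>1\<close> be a variable that does not occur in the \<open>f\<^sub>j\<close> and put
  \[ C = \sum_\sigma \mathrm{sgn}(\sigma)\, f_{\sigma 1}\, y\, f_{\sigma 2}\, y \cdots y\, f_{\sigma m}. \]
  As a function of the entries this expression is multilinear and alternating over any algebra, so
  it vanishes at linearly dependent entries; since evaluation is a homomorphism, \<open>C\<close> vanishes on
  the algebra as soon as the \<open>f\<^sub>j\<close> are locally linearly dependent
  (\<open>capelli_eq_0_if_dependent\<close>).

  On the other hand \<open>C \<noteq> 0\<close> if the \<open>f\<^sub>j\<close> are linearly independent (\<open>capelli_nonzero\<close>): the letter
  \<open>y\<close> acts as a tensor sign, because a word with letters \<open>y\<close> in it can be cut at its first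
  \<open>y\<close> in one way only, and \<open>C\<close> corresponds to the nonzero tensor
  \<open>f\<^sub>1 \<and> \<dots> \<and> f\<^sub>m\<close>.  So if the \<open>f\<^sub>j\<close> were linearly independent, \<open>C\<close> would be a polynomial
  identity.

  The degree of \<open>C\<close> is at most \<open>\<beta>\<close>, but it can be smaller, since the leading terms may cancel: for
  \<open>f\<^sub>1 = X\<^sub>1\<close> and \<open>f\<^sub>2 = X\<^sub>1 + 1\<close> one gets \<open>X\<^sub>1 y - y X\<^sub>1\<close>.  Multiplying an identity by a
  monomial gives another one, with the degree increased by the length of the monomial, so an
  identity of degree exactly \<open>\<beta>\<close> exists.
\<close>

section \<open>Signed sums over the entries of a list\<close>

text \<open>
  The shape of a Laplace expansion along the first row: each entry \<open>x\<close> is taken out in turn, with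
  sign \<open>(-1)\<^sup>i\<close> for the position \<open>i\<close>, and \<open>h\<close> receives it together with the remaining entries.
\<close>

primrec laplace :: "('a \<Rightarrow> 'a list \<Rightarrow> 'b::ab_group_add) \<Rightarrow> 'a list \<Rightarrow> 'b" where
  "laplace h [] = 0"
| "laplace h (x # xs) = h x xs - laplace (\<lambda>y ys. h y (x # ys)) xs"

lemma laplace_cong:
  assumes "\<And>x ys. x \<in> set xs \<Longrightarrow> h x ys = g x ys"
  shows "laplace h xs = laplace g xs"
  using assms
proof (induction xs arbitrary: h g)
  case (Cons a xs)
  have "laplace (\<lambda>y ys. h y (a # ys)) xs = laplace (\<lambda>y ys. g y (a # ys)) xs"
    by (rule Cons.IH) (simp add: Cons.prems)
  then show ?case by (simp add: Cons.prems)
qed simp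

lemma laplace_closed:
  assumes "\<And>x ys. mset xs = add_mset x (mset ys) \<Longrightarrow> P (h x ys)"
    and "P 0" and "\<And>a b. P a \<Longrightarrow> P b \<Longrightarrow> P (a - b)"
  shows "P (laplace h xs)"
  using assms(1)
proof (induction xs arbitrary: h)
  case (Cons a xs)
  have "P (laplace (\<lambda>y ys. h y (a # ys)) xs)"
    by (rule Cons.IH) (simp add: Cons.prems)
  then show ?case by (simp add: Cons.prems assms(3))
qed (simp add: assms(2))

lemma laplace_hom:
  assumes "e 0 = 0" and "\<And>a b. e (a - b) = e a - e b"
  shows "e (laplace h xs) = laplace (\<lambda>x ys. e (h x ys)) xs"
  by (induction xs arbitrary: h) (simp_all add: assms)

lemma laplace_map:
  "laplace h (map e xs) = laplace (\<lambda>x ys. h (e x) (map e ys)) xs"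
  by (induction xs arbitrary: h) simp_all

lemma laplace_zero [simp]: "laplace (\<lambda>x ys. 0) xs = 0"
  by (induction xs) simp_all

lemma laplace_uminus: "laplace (\<lambda>x ys. - h x ys) xs = - laplace h xs"
  by (rule laplace_hom [symmetric]) simp_all

lemma laplace_add:
  "laplace (\<lambda>x ys. h x ys + g x ys) xs = laplace h xs + laplace g xs"
  by (induction xs arbitrary: h g) (simp_all add: algebra_simps)

text \<open>
  The two terms that take out one of two neighbours \<open>u\<close>, \<open>v\<close> have opposite signs and are exchanged
  by the swap; in all other terms \<open>u\<close> and \<open>v\<close> remain neighbours in the argument of \<open>h\<close>.
\<close>

lemma laplace_swap:
  assumes "\<And>x as bs. h x (as @ u # v # bs) = - h x (as @ v # u # bs)"
  shows "laplace h (xs @ u # v # ys) = - laplace h (xs @ v # u # ys)"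
  using assms
proof (induction xs arbitrary: h)
  case Nil
  have "h y (u # v # zs) = - h y (v # u # zs)" for y zs
    using Nil [of y "[]" zs] by simp
  then show ?case by (simp add: laplace_uminus)
next
  case (Cons x xs)
  have "laplace (\<lambda>y zs. h y (x # zs)) (xs @ u # v # ys)
      = - laplace (\<lambda>y zs. h y (x # zs)) (xs @ v # u # ys)"
    by (rule Cons.IH) (use Cons.prems [of _ "x # _"] in simp)
  then show ?case by (simp add: Cons.prems)
qed

lemma laplace_repeat:
  assumes "\<And>x as bs. h x (as @ v # v # bs) = 0"
  shows "laplace h (xs @ v # v # ys) = 0"
  using assms
proof (induction xs arbitrary: h)
  case Nil
  have "h y (v # v # zs) = 0" for y zs
    using Nil [of y "[]" zs] by simp
  then show ?case by simp
next
  case (Cons x xs)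
  have "laplace (\<lambda>y zs. h y (x # zs)) (xs @ v # v # ys) = 0"
    by (rule Cons.IH) (use Cons.prems [of _ "x # _"] in simp)
  then show ?case by (simp add: Cons.prems)
qed


section \<open>The Capelli expression\<close>

text \<open>
  For a list \<open>xs\<close> of length \<open>k + 1\<close> this is the sum over all permutations of
  \<open>\<plusminus> x y x' y \<cdots> y x''\<close>, with \<open>k\<close> separators \<open>y\<close>.  Giving the value \<open>0\<close> to
  lists of other lengths at \<open>k = 0\<close> makes the following identities hold for lists of any length.
\<close>

primrec capelli :: "'a::ring \<Rightarrow> nat \<Rightarrow> 'a list \<Rightarrow> 'a" where
  "capelli y 0 xs = (case xs of [x] \<Rightarrow> x | _ \<Rightarrow> 0)"
| "capelli y (Suc k) xs = laplace (\<lambda>x ys. x * (y * capelli y k ys)) xs"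

lemma capelli_hom:
  assumes "e 0 = 0" and "\<And>a b. e (a - b) = e a - e b" and "\<And>a b. e (a * b) = e a * e b"
  shows "e (capelli y k xs) = capelli (e y) k (map e xs)"
proof (induction k arbitrary: xs)
  case 0
  show ?case by (simp add: assms(1) split: list.split)
next
  case (Suc k)
  have "e (capelli y (Suc k) xs) = laplace (\<lambda>x ys. e (x * (y * capelli y k ys))) xs"
    by (simp add: laplace_hom [of e, OF assms(1,2)])
  then show ?case by (simp add: assms(3) Suc.IH laplace_map)
qed

lemma capelli_swap:
  "capelli y k (xs @ u # v # ys) = - capelli y k (xs @ v # u # ys)"
proof (induction k arbitrary: xs ys)
  case 0
  show ?case by (cases xs) (auto split: list.split)
next
  case (Suc k)
  show ?case
    unfolding capelli.simps by (rule laplace_swap) (subst Suc.IH, simp)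
qed

lemma capelli_repeat: "capelli y k (xs @ v # v # ys) = 0"
proof (induction k arbitrary: xs ys)
  case 0
  show ?case by (cases xs) (auto split: list.split)
next
  case (Suc k)
  show ?case
    unfolding capelli.simps by (rule laplace_repeat) (simp add: Suc.IH)
qed

lemma capelli_move_eq_0:
  "capelli y k (zs @ v # xs @ ys) = 0 \<longleftrightarrow> capelli y k (zs @ xs @ v # ys) = 0"
proof (induction xs arbitrary: zs)
  case (Cons x xs)
  have "capelli y k (zs @ v # x # xs @ ys) = - capelli y k (zs @ x # v # xs @ ys)"
    by (rule capelli_swap)
  then show ?case
    using Cons.IH [of "zs @ [x]"] by simp
qed simp

lemma capelli_not_distinct:
  assumes "v \<in> set xs"
  shows "capelli y k (v # xs) = 0"
proof -
  obtain as bs where xs: "xs = as @ v # bs"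
    using assms by (auto dest: split_list)
  have "capelli y k (as @ v # v # bs) = 0"
    by (rule capelli_repeat)
  then show ?thesis
    using capelli_move_eq_0 [of y k "[]" v as "v # bs"] xs by simp
qed

text \<open>
  Linearity is needed in the first entry only, since an entry can be moved to the front at the
  cost of a sign.
\<close>

context assoc_algebra
begin

lemma capelli_scale_first: "capelli y k (scale c u # xs) = scale c (capelli y k (u # xs))"
proof (induction k arbitrary: xs)
  case 0
  show ?case by (simp split: list.split)
next
  case (Suc k)
  have "laplace (\<lambda>x ys. x * (y * capelli y k (scale c u # ys))) xs
      = laplace (\<lambda>x ys. scale c (x * (y * capelli y k (u # ys)))) xs"
    by (simp add: Suc.IH scale_mult_right)
  also have "\<dots> = scale c (laplace (\<lambda>x ys. x * (y * capelli y k (u # ys))) xs)"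
    by (rule laplace_hom [symmetric]) (simp_all add: scale_right_diff_distrib)
  finally show ?case
    by (simp add: scale_right_diff_distrib scale_mult_left)
qed

lemma capelli_add_first:
  "capelli y k ((u + v) # xs) = capelli y k (u # xs) + capelli y k (v # xs)"
proof (induction k arbitrary: xs)
  case 0
  show ?case by (simp split: list.split)
next
  case (Suc k)
  have "laplace (\<lambda>x ys. x * (y * capelli y k ((u + v) # ys))) xs
      = laplace (\<lambda>x ys. x * (y * capelli y k (u # ys))) xs
        + laplace (\<lambda>x ys. x * (y * capelli y k (v # ys))) xs"
    by (simp add: Suc.IH distrib_left laplace_add)
  then show ?case by (simp add: distrib_right)
qed

lemma capelli_zero_first: "capelli y k (0 # xs) = 0" for y :: 'a
  using capelli_scale_first [of y k 0 0 xs] by simp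

lemma capelli_sum_first:
  "capelli y k ((\<Sum>j\<in>J. scale (\<alpha> j) (v j)) # xs) = (\<Sum>j\<in>J. scale (\<alpha> j) (capelli y k (v j # xs)))"
  by (induction J rule: infinite_finite_induct)
    (simp_all add: capelli_zero_first capelli_add_first capelli_scale_first)

text \<open>
  If \<open>\<Sum>\<^sub>j \<alpha>\<^sub>j v\<^sub>j = 0\<close> with \<open>\<alpha>\<^sub>i \<noteq> 0\<close>, replace the \<open>i\<close>-th entry by this sum: the value is \<open>0\<close>, and
  expanding it leaves only \<open>\<alpha>\<^sub>i\<close> times the original value, up to sign.
\<close>

lemma capelli_eq_0_if_dependent:
  assumes "lin_dependent scale m v"
  shows "capelli y k (map v [1..<Suc m]) = 0"
proof -
  obtain \<alpha> i where i: "i \<in> {1..m}" "\<alpha> i \<noteq> 0" and sum0: "(\<Sum>j = 1..m. scale (\<alpha> j) (v j)) = 0"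
    using assms unfolding lin_dependent_def by blast
  define xs ys where "xs = map v [1..<i]" and "ys = map v [Suc i..<Suc m]"
  have "[1..<Suc m] = [1..<i] @ i # [Suc i..<Suc m]"
    using i(1) upt_add_eq_append [of 1 i "Suc m - i"] upt_conv_Cons [of i "Suc m"] by simp
  then have split: "map v [1..<Suc m] = xs @ v i # ys"
    by (simp only: xs_def ys_def map_append list.map)
  have others: "capelli y k (v j # xs @ ys) = 0" if "j \<in> {1..m} - {i}" for j
  proof (rule capelli_not_distinct)
    have "j \<in> {1..<i} \<union> {Suc i..<Suc m}"
      using that by auto
    then show "v j \<in> set (xs @ ys)"
      unfolding xs_def ys_def by (auto simp del: upt_Suc)
  qed
  have "0 = capelli y k ((\<Sum>j = 1..m. scale (\<alpha> j) (v j)) # xs @ ys)"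
    by (simp only: sum0 capelli_zero_first)
  also have "\<dots> = (\<Sum>j = 1..m. scale (\<alpha> j) (capelli y k (v j # xs @ ys)))"
    by (rule capelli_sum_first)
  also have "\<dots> = scale (\<alpha> i) (capelli y k (v i # xs @ ys))"
    using i(1) others by (subst sum.remove [of _ i]) simp_all
  finally have "capelli y k (v i # xs @ ys) = 0"
    using i(2) by (simp add: scale_eq_0_iff)
  then show ?thesis
    unfolding split using capelli_move_eq_0 [of y k "[]" "v i" xs ys] by simp
qed

end


section \<open>Coefficients, degree and evaluation in the free algebra\<close>

lemma ncpoly_induct [case_names zero single add]:
  fixes p :: "'b \<Rightarrow>\<^sub>0 'c::comm_monoid_add"
  assumes "P 0" and "\<And>w c. P (Poly_Mapping.single w c)"
    and "\<And>p q. P p \<Longrightarrow> P q \<Longrightarrow> P (p + q)"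
  shows "P p"
proof (induction p rule: update_induct)
  case (update p w c)
  have "Poly_Mapping.update w c p = p + Poly_Mapping.single w c"
    using update(1)
    by (intro poly_mapping_eqI)
      (auto simp: lookup_update lookup_add lookup_single in_keys_iff when_def)
  then show ?case using update assms by simp
qed (rule assms(1))

lemma lookup_mult_list:
  fixes p q :: "'b list \<Rightarrow>\<^sub>0 'c::semiring_0"
  shows "Poly_Mapping.lookup (p * q) w
    = (\<Sum>i\<le>length w. Poly_Mapping.lookup p (take i w) * Poly_Mapping.lookup q (drop i w))"
proof (induction p rule: ncpoly_induct)
  case (single u a)
  show ?case
  proof (induction q rule: ncpoly_induct)
    case (single v b)
    have "(\<Sum>i\<le>length w. Poly_Mapping.lookup (Poly_Mapping.single u a) (take i w)
          * Poly_Mapping.lookup (Poly_Mapping.single v b) (drop i w))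
        = (\<Sum>i\<le>length w. if i = length u then (a * b when u @ v = w) else 0)"
    proof (rule sum.cong)
      fix i assume "i \<in> {..length w}"
      then have "u = take i w \<and> v = drop i w \<longleftrightarrow> i = length u \<and> u @ v = w"
        by (auto dest: sym)
      then show "Poly_Mapping.lookup (Poly_Mapping.single u a) (take i w)
          * Poly_Mapping.lookup (Poly_Mapping.single v b) (drop i w)
          = (if i = length u then (a * b when u @ v = w) else 0)"
        unfolding lookup_single when_def by (cases "u = take i w"; cases "v = drop i w") auto
    qed simp
    also have "\<dots> = (a * b when u @ v = w)"
      by (auto simp: when_def)
    finally show ?case
      by (simp add: mult_single plus_list_def lookup_single)
  qed (simp_all add: distrib_left lookup_add sum.distrib)
qed (simp_all add: distrib_right lookup_add sum.distrib)

text \<open>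
  A word can be cut in only one way at its first letter \<open>l\<close>, so multiplying through a letter that
  \<open>p\<close> lacks makes the coefficients multiply as in a tensor product.
\<close>

lemma lookup_mult_separator:
  fixes p q :: "'f::field ncpoly"
  assumes p: "\<forall>w\<in>Poly_Mapping.keys p. l \<notin> set w" and u: "l \<notin> set u"
  shows "Poly_Mapping.lookup (p * (Poly_Mapping.single [l] 1 * q)) (u @ l # w)
    = Poly_Mapping.lookup p u * Poly_Mapping.lookup q w"
proof -
  let ?X = "Poly_Mapping.single [l] (1::'f)"
  have X_Cons: "Poly_Mapping.lookup (?X * q) (a # v)
      = (if a = l then Poly_Mapping.lookup q v else 0)" for a v
  proof -
    have "Poly_Mapping.lookup (?X * q) (a # v)
        = (\<Sum>i\<le>Suc (length v). if i = 1 then (if a = l then Poly_Mapping.lookup q v else 0) else 0)"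
      unfolding lookup_mult_list list.size add_0_right add_Suc_right
    proof (rule sum.cong)
      fix i assume i: "i \<in> {..Suc (length v)}"
      show "Poly_Mapping.lookup ?X (take i (a # v)) * Poly_Mapping.lookup q (drop i (a # v))
          = (if i = 1 then (if a = l then Poly_Mapping.lookup q v else 0) else 0)"
        using i by (cases i; cases v) (auto simp: lookup_single when_def take_Cons')
    qed simp
    also have "\<dots> = (if a = l then Poly_Mapping.lookup q v else 0)"
      by (simp del: sum.atMost_Suc)
    finally show ?thesis .
  qed
  have "Poly_Mapping.lookup (p * (?X * q)) (u @ l # w)
      = (\<Sum>i\<le>length (u @ l # w). if i = length u
          then Poly_Mapping.lookup p u * Poly_Mapping.lookup q w else 0)"
    unfolding lookup_mult_list [of p]
  proof (rule sum.cong)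
    fix i
    consider "i < length u" | "i = length u" | "i > length u" by linarith
    then show "Poly_Mapping.lookup p (take i (u @ l # w))
        * Poly_Mapping.lookup (?X * q) (drop i (u @ l # w))
        = (if i = length u then Poly_Mapping.lookup p u * Poly_Mapping.lookup q w else 0)"
    proof cases
      case 1
      have "u ! i \<noteq> l" using u 1 by auto
      then show ?thesis
        using 1 by (simp add: Cons_nth_drop_Suc [symmetric] X_Cons)
    next
      case 2
      then show ?thesis by (simp add: X_Cons)
    next
      case 3
      have "l \<in> set (take i (u @ l # w))"
        using 3 by (cases "i - length u") auto
      then have "Poly_Mapping.lookup p (take i (u @ l # w)) = 0"
        using p by (metis in_keys_iff)
      then show ?thesis using 3 by simp
    qed
  qed simp
  also have "\<dots> = Poly_Mapping.lookup p u * Poly_Mapping.lookup q w"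
    by simp
  finally show ?thesis .
qed

lemma nc_deg_le_iff: "nc_deg p \<le> d \<longleftrightarrow> (\<forall>w\<in>Poly_Mapping.keys p. length w \<le> d)"
  by (cases "p = 0") (simp_all add: nc_deg_def)

lemma length_le_nc_deg: "w \<in> Poly_Mapping.keys p \<Longrightarrow> length w \<le> nc_deg p"
  using nc_deg_le_iff by blast

lemma nc_deg_diff_le: "nc_deg p \<le> d \<Longrightarrow> nc_deg q \<le> d \<Longrightarrow> nc_deg (p - q) \<le> d"
  unfolding nc_deg_le_iff using keys_diff [of p q] by auto

lemma nc_deg_mult_le: "nc_deg (p * q) \<le> nc_deg p + nc_deg q"
  unfolding nc_deg_le_iff
proof
  fix w assume "w \<in> Poly_Mapping.keys (p * q)"
  then obtain u v where "w = u @ v" "u \<in> Poly_Mapping.keys p" "v \<in> Poly_Mapping.keys q"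
    using keys_mult [of p q] by (auto simp: plus_list_def)
  then show "length w \<le> nc_deg p + nc_deg q"
    by (simp add: add_mono length_le_nc_deg)
qed

lemma nc_deg_single: "nc_deg (Poly_Mapping.single w (1::'f::field)) = length w"
proof -
  have "Poly_Mapping.single w (1::'f) \<noteq> 0"
    by (metis lookup_single_eq lookup_zero zero_neq_one)
  then show ?thesis by (simp add: nc_deg_def)
qed

lemma free_algebra_zero: "0 \<in> free_algebra n"
  by (simp add: free_algebra_def)

lemma free_algebra_diff:
  "p \<in> free_algebra n \<Longrightarrow> q \<in> free_algebra n \<Longrightarrow> p - q \<in> free_algebra n"
  unfolding free_algebra_def using keys_diff [of p q] by auto

lemma free_algebra_mult:
  assumes "p \<in> free_algebra n" and "q \<in> free_algebra n"
  shows "p * q \<in> free_algebra n"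
  unfolding free_algebra_def
proof (intro CollectI ballI)
  fix w assume "w \<in> Poly_Mapping.keys (p * q)"
  then obtain u v where "w = u @ v" "u \<in> Poly_Mapping.keys p" "v \<in> Poly_Mapping.keys q"
    using keys_mult [of p q] by (auto simp: plus_list_def)
  then show "set w \<subseteq> {1..n}"
    using assms by (simp add: free_algebra_def)
qed

lemma free_algebra_mono: "n \<le> N \<Longrightarrow> free_algebra n \<subseteq> free_algebra N"
  unfolding free_algebra_def
proof (intro Collect_mono impI ballI)
  fix p :: "'a ncpoly" and w
  assume "n \<le> N" and "\<forall>w\<in>Poly_Mapping.keys p. set w \<subseteq> {1..n}" and "w \<in> Poly_Mapping.keys p"
  then have "set w \<subseteq> {1..n}" and "{1..n} \<subseteq> {1..N}"
    by simp_all
  then show "set w \<subseteq> {1..N}"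
    by (rule order_trans)
qed

lemma free_algebra_single: "set w \<subseteq> {1..n} \<Longrightarrow> Poly_Mapping.single w c \<in> free_algebra n"
  by (simp add: free_algebra_def)

lemma lookup_nc_scale: "Poly_Mapping.lookup (nc_scale c p) w = c * Poly_Mapping.lookup p w"
  by (auto simp: nc_scale_def map.rep_eq when_def)

interpretation ncpoly: vector_space nc_scale
  by unfold_locales
    (auto intro!: poly_mapping_eqI simp: lookup_nc_scale lookup_add algebra_simps)

text \<open>
  The product of a word of maximal length with the monomial cannot cancel, so the degree is
  additive here and the product is nonzero.
\<close>

lemma mult_monomial_right:
  fixes p :: "'f::field ncpoly"
  assumes "p \<noteq> 0"
  shows "p * Poly_Mapping.single v 1 \<noteq> 0"
    and "nc_deg (p * Poly_Mapping.single v 1) = nc_deg p + length v"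
proof -
  let ?M = "Poly_Mapping.single v (1::'f)"
  have "Max (length ` Poly_Mapping.keys p) \<in> length ` Poly_Mapping.keys p"
    using assms by (intro Max_in) auto
  moreover have "nc_deg p = Max (length ` Poly_Mapping.keys p)"
    using assms by (simp add: nc_deg_def)
  ultimately obtain w where w: "w \<in> Poly_Mapping.keys p" "length w = nc_deg p"
    by force
  have "Poly_Mapping.lookup (p * ?M) (w @ v)
      = (\<Sum>i\<le>length (w @ v). if i = length w then Poly_Mapping.lookup p w else 0)"
    unfolding lookup_mult_list
  proof (rule sum.cong)
    fix i assume i: "i \<in> {..length (w @ v)}"
    have "length (drop i (w @ v)) \<noteq> length v" if "i \<noteq> length w"
      using i that by (simp only: length_drop length_append atMost_iff)
    then have "drop i (w @ v) \<noteq> v" if "i \<noteq> length w"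
      using that by metis
    then show "Poly_Mapping.lookup p (take i (w @ v)) * Poly_Mapping.lookup ?M (drop i (w @ v))
        = (if i = length w then Poly_Mapping.lookup p w else 0)"
      by (auto simp: lookup_single when_def)
  qed simp
  then have key: "w @ v \<in> Poly_Mapping.keys (p * ?M)"
    using w(1) by (simp add: in_keys_iff)
  then show "p * ?M \<noteq> 0" by auto
  have "nc_deg (p * ?M) \<le> nc_deg p + length v"
    using nc_deg_mult_le [of p ?M] by (simp add: nc_deg_single)
  then show "nc_deg (p * ?M) = nc_deg p + length v"
    using length_le_nc_deg [OF key] w(2) by simp
qed

context assoc_algebra
begin

lemma nc_eval_superset:
  assumes "finite S" and "Poly_Mapping.keys p \<subseteq> S"
  shows "nc_eval scale p a = (\<Sum>w\<in>S. scale (Poly_Mapping.lookup p w) (prod_list (map a w)))"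
  unfolding nc_eval_def using assms
  by (intro sum.mono_neutral_left) (auto simp: in_keys_iff)

lemma nc_eval_zero [simp]: "nc_eval scale 0 a = 0"
  by (simp add: nc_eval_def)

lemma nc_eval_single: "nc_eval scale (Poly_Mapping.single w c) a = scale c (prod_list (map a w))"
  by (simp add: nc_eval_superset [of "{w}"])

lemma nc_eval_add: "nc_eval scale (p + q) a = nc_eval scale p a + nc_eval scale q a"
proof -
  let ?S = "Poly_Mapping.keys p \<union> Poly_Mapping.keys q"
  show ?thesis
    using keys_add [of p q]
    by (simp add: nc_eval_superset [of ?S] lookup_add scale_left_distrib sum.distrib)
qed

lemma nc_eval_diff: "nc_eval scale (p - q) a = nc_eval scale p a - nc_eval scale q a"
  using nc_eval_add [of "p - q" q a] by (simp add: algebra_simps)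

lemma nc_eval_mult: "nc_eval scale (p * q) a = nc_eval scale p a * nc_eval scale q a"
proof (induction p rule: ncpoly_induct)
  case (single u b)
  show ?case
  proof (induction q rule: ncpoly_induct)
    case (single v c)
    show ?case
      by (simp add: mult_single plus_list_def nc_eval_single scale_mult_left scale_mult_right)
  qed (simp_all add: distrib_left nc_eval_add)
qed (simp_all add: distrib_right nc_eval_add)

lemma nc_eval_capelli:
  "nc_eval scale (capelli y k fs) a
    = capelli (nc_eval scale y a) k (map (\<lambda>f. nc_eval scale f a) fs)"
  by (rule capelli_hom [of "\<lambda>f. nc_eval scale f a"]) (simp_all add: nc_eval_diff nc_eval_mult)

lemma polynomial_identity_mult_monomial:
  assumes "polynomial_identity scale p"
  shows "polynomial_identity scale (p * Poly_Mapping.single (replicate r 1) 1)"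
proof -
  obtain N where "p \<in> free_algebra N"
    using assms by (auto simp: polynomial_identity_def)
  then have "p \<in> free_algebra (Suc N)"
    using free_algebra_mono [of N "Suc N"] by auto
  moreover have "Poly_Mapping.single (replicate r 1) (1::'f) \<in> free_algebra (Suc N)"
    by (rule free_algebra_single) auto
  ultimately have "p * Poly_Mapping.single (replicate r 1) 1 \<in> free_algebra (Suc N)"
    by (rule free_algebra_mult)
  then show ?thesis
    using assms mult_monomial_right(1) [of p "replicate r 1"]
    by (auto simp: polynomial_identity_def nc_eval_mult)
qed

end


section \<open>The Capelli polynomial of linearly independent polynomials\<close>

lemma capelli_free_algebra:
  assumes "y \<in> free_algebra n" and "set fs \<subseteq> free_algebra n"
  shows "capelli y k fs \<in> free_algebra n"
  using assms(2)
proof (induction k arbitrary: fs)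
  case 0
  then show ?case by (auto simp: free_algebra_zero split: list.split)
next
  case (Suc k)
  show ?case unfolding capelli.simps
  proof (rule laplace_closed)
    fix g gs assume "mset fs = add_mset g (mset gs)"
    then have "set fs = insert g (set gs)"
      by (metis set_mset_add_mset_insert set_mset_mset)
    then show "g * (y * capelli y k gs) \<in> free_algebra n"
      using Suc assms(1) by (auto intro!: free_algebra_mult)
  qed (auto simp: free_algebra_zero free_algebra_diff)
qed

lemma nc_deg_capelli_le:
  "nc_deg (capelli (Poly_Mapping.single [l] 1) k fs) \<le> sum_list (map nc_deg fs) + k"
proof (induction k arbitrary: fs)
  case 0
  show ?case by (auto simp: nc_deg_def split: list.split)
next
  case (Suc k)
  let ?X = "Poly_Mapping.single [l] (1::'a)"
  show ?case unfolding capelli.simps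
  proof (rule laplace_closed)
    fix g gs assume "mset fs = add_mset g (mset gs)"
    then have "mset (map nc_deg fs) = mset (map nc_deg (g # gs))"
      by simp
    then have *: "sum_list (map nc_deg fs) = nc_deg g + sum_list (map nc_deg gs)"
      by (metis sum_mset_sum_list list.simps(9) sum_list.Cons)
    have "nc_deg (g * (?X * capelli ?X k gs)) \<le> nc_deg g + nc_deg (?X * capelli ?X k gs)"
      by (rule nc_deg_mult_le)
    also have "nc_deg (?X * capelli ?X k gs) \<le> 1 + nc_deg (capelli ?X k gs)"
      using nc_deg_mult_le [of ?X "capelli ?X k gs"] by (simp add: nc_deg_single)
    finally show "nc_deg (g * (?X * capelli ?X k gs)) \<le> sum_list (map nc_deg fs) + Suc k"
      using Suc.IH [of gs] * by simp
  qed (auto simp: nc_deg_diff_le nc_deg_def [of 0])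
qed

text \<open>
  Linear independence as a family, so that a repeated entry violates it, in a form that follows
  the recursion of the expansion along the first entry.
\<close>

primrec independent_list :: "'f::field ncpoly list \<Rightarrow> bool" where
  "independent_list [] \<longleftrightarrow> True"
| "independent_list (f # fs) \<longleftrightarrow> f \<notin> ncpoly.span (set fs) \<and> independent_list fs"

lemma in_span_imageE:
  assumes "finite J" and "x \<in> ncpoly.span (f ` J)"
  obtains c where "x = (\<Sum>j\<in>J. nc_scale (c j) (f j))"
proof -
  have "\<exists>c. x = (\<Sum>j\<in>J. nc_scale (c j) (f j))"
    using assms
  proof (induction J arbitrary: x rule: finite_induct)
    case empty
    then show ?case by simp
  next
    case (insert i J)
    have "\<exists>k. x - nc_scale k (f i) \<in> ncpoly.span (f ` J)"
      using insert.prems by (simp only: image_insert ncpoly.span_breakdown_eq)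
    then obtain k where "x - nc_scale k (f i) \<in> ncpoly.span (f ` J)"
      by blast
    then obtain c where c: "x - nc_scale k (f i) = (\<Sum>j\<in>J. nc_scale (c j) (f j))"
      using insert.IH by blast
    have "(\<Sum>j\<in>J. nc_scale ((c(i := k)) j) (f j)) = (\<Sum>j\<in>J. nc_scale (c j) (f j))"
      using insert.hyps by (intro sum.cong) auto
    then have "x = (\<Sum>j\<in>insert i J. nc_scale ((c(i := k)) j) (f j))"
      using c insert.hyps by (simp add: algebra_simps)
    then show ?case by blast
  qed
  then show ?thesis using that by blast
qed

lemma independent_list_if_not_lin_dependent:
  assumes "\<not> lin_dependent nc_scale m f" and "1 \<le> i" and "i \<le> Suc m"
  shows "independent_list (map f [i..<Suc m])"
  using assms(3,2)
proof (induction i rule: inc_induct)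
  case (step i)
  have "f i \<notin> ncpoly.span (f ` {Suc i..m})"
  proof
    assume "f i \<in> ncpoly.span (f ` {Suc i..m})"
    then obtain c where c: "f i = (\<Sum>j\<in>{Suc i..m}. nc_scale (c j) (f j))"
      by (rule in_span_imageE [rotated]) simp_all
    define \<alpha> where "\<alpha> j = (if j = i then - 1 else if j > i then c j else 0)" for j
    have "(\<Sum>j = 1..m. nc_scale (\<alpha> j) (f j)) = (\<Sum>j = i..m. nc_scale (\<alpha> j) (f j))"
      using step by (intro sum.mono_neutral_right) (auto simp: \<alpha>_def)
    also have "\<dots> = nc_scale (\<alpha> i) (f i) + (\<Sum>j = Suc i..m. nc_scale (\<alpha> j) (f j))"
      using step by (intro sum.atLeast_Suc_atMost) simp
    also have "(\<Sum>j = Suc i..m. nc_scale (\<alpha> j) (f j)) = f i"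
      unfolding c by (intro sum.cong) (auto simp: \<alpha>_def)
    also have "nc_scale (\<alpha> i) (f i) + f i = 0"
      by (simp add: \<alpha>_def)
    finally have "(\<Sum>j = 1..m. nc_scale (\<alpha> j) (f j)) = 0" .
    moreover have "i \<in> {1..m}" "\<alpha> i \<noteq> 0"
      using step by (auto simp: \<alpha>_def)
    ultimately show False
      using assms(1) unfolding lin_dependent_def by blast
  qed
  moreover have "[i..<Suc m] = i # [Suc i..<Suc m]"
    using step by (intro upt_conv_Cons) simp
  moreover have "set (map f [Suc i..<Suc m]) = f ` {Suc i..m}"
    by (simp only: set_map set_upt atLeastLessThanSuc_atLeastAtMost)
  ultimately show ?case
    using step by (simp del: upt_Suc)
qed simp

text \<open>
  Cut at the first separator: the coefficient of \<open>u l w\<close> is \<open>\<Sum>\<^sub>i \<plusminus> f\<^sub>i(u) C\<^sub>i(w)\<close>, where \<open>C\<^sub>i\<close> is the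
  Capelli polynomial without the entry \<open>f\<^sub>i\<close>.  If all these vanish, then for every \<open>w\<close> the
  combination \<open>\<Sum>\<^sub>i \<plusminus> C\<^sub>i(w) f\<^sub>i\<close> is \<open>0\<close>, whereas inductively some coefficient of the first \<open>C\<^sub>i\<close> is
  nonzero.
\<close>

lemma capelli_nonzero:
  fixes fs :: "'f::field ncpoly list"
  assumes "independent_list fs" and "length fs = Suc k"
    and "\<forall>f\<in>set fs. \<forall>w\<in>Poly_Mapping.keys f. l \<notin> set w"
  shows "capelli (Poly_Mapping.single [l] 1) k fs \<noteq> 0"
  using assms
proof (induction k arbitrary: fs)
  case 0
  then show ?case by (auto simp: length_Suc_conv)
next
  case (Suc k)
  let ?X = "Poly_Mapping.single [l] (1::'f)"
  obtain f gs where fs: "fs = f # gs" and "length gs = Suc k"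
    using Suc.prems(2) by (auto simp: length_Suc_conv)
  then have "capelli ?X k gs \<noteq> 0"
    using Suc.prems by (intro Suc.IH) auto
  then obtain w where c: "Poly_Mapping.lookup (capelli ?X k gs) w \<noteq> 0"
    by (metis poly_mapping_eqI lookup_zero)
  define h where "h x ys = nc_scale (Poly_Mapping.lookup (capelli ?X k ys) w) x" for x ys
  show ?case
  proof
    assume zero: "capelli ?X (Suc k) fs = 0"
    have lookup_laplace: "Poly_Mapping.lookup (laplace g xs) v
        = laplace (\<lambda>x ys. Poly_Mapping.lookup (g x ys) v) xs"
      for g :: "'f ncpoly \<Rightarrow> 'f ncpoly list \<Rightarrow> 'f ncpoly" and xs v
      by (rule laplace_hom) (simp_all add: lookup_minus)
    have "laplace h fs = 0"
    proof (rule poly_mapping_eqI)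
      fix u
      have "laplace (\<lambda>x ys. Poly_Mapping.lookup (h x ys) u) fs = 0"
      proof (cases "l \<in> set u")
        case True
        then have "laplace (\<lambda>x ys. Poly_Mapping.lookup (h x ys) u) fs = laplace (\<lambda>x ys. 0) fs"
          using Suc.prems(3)
          by (intro laplace_cong) (auto simp: h_def lookup_nc_scale in_keys_iff)
        then show ?thesis by simp
      next
        case False
        have "laplace (\<lambda>x ys. Poly_Mapping.lookup (h x ys) u) fs
            = laplace (\<lambda>x ys. Poly_Mapping.lookup (x * (?X * capelli ?X k ys)) (u @ l # w)) fs"
          using Suc.prems(3) False
          by (intro laplace_cong) (simp add: h_def lookup_nc_scale lookup_mult_separator)
        also have "\<dots> = Poly_Mapping.lookup (capelli ?X (Suc k) fs) (u @ l # w)"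
          by (simp add: lookup_laplace)
        finally show ?thesis by (simp only: zero lookup_zero)
      qed
      then show "Poly_Mapping.lookup (laplace h fs) u = Poly_Mapping.lookup 0 u"
        by (simp add: lookup_laplace)
    qed
    then have eq: "h f gs = laplace (\<lambda>y ys. h y (f # ys)) gs"
      by (simp add: fs)
    have "laplace (\<lambda>y ys. h y (f # ys)) gs \<in> ncpoly.span (set gs)"
    proof (rule laplace_closed)
      fix y ys assume "mset gs = add_mset y (mset ys)"
      then have "y \<in> set gs"
        by (metis set_mset_mset union_single_eq_member)
      then show "h y (f # ys) \<in> ncpoly.span (set gs)"
        by (simp add: h_def ncpoly.span_scale ncpoly.span_base)
    qed (auto simp: ncpoly.span_zero ncpoly.span_diff)
    then have "nc_scale (inverse (Poly_Mapping.lookup (capelli ?X k gs) w)) (h f gs)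
        \<in> ncpoly.span (set gs)"
      unfolding eq by (rule ncpoly.span_scale)
    then have "f \<in> ncpoly.span (set gs)"
      using c by (simp add: h_def)
    then show False
      using Suc.prems(1) fs by simp
  qed
qed


section \<open>Local linear dependence\<close>

theorem theorem3p1:
  fixes scale :: "'f::field \<Rightarrow> 'a::{ring, monoid_mult} \<Rightarrow> 'a"
    and m n :: nat
    and f :: "nat \<Rightarrow> 'f ncpoly"
  assumes "assoc_algebra scale"
    and "m \<ge> 1" and "n \<ge> 1"
    and "\<forall>j\<in>{1..m}. f j \<in> free_algebra n"
    and "locally_lin_dependent scale m f"
    and "\<not> (\<exists>p. polynomial_identity scale p \<and> nc_deg p = (\<Sum>j = 1..m. nc_deg (f j)) + m - 1)"
  shows "lin_dependent nc_scale m f"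
proof (rule ccontr)
  assume indep: "\<not> lin_dependent nc_scale m f"
  interpret assoc_algebra scale by (rule assms(1))
  let ?y = "Poly_Mapping.single [Suc n] (1::'f)"
  define fs where "fs = map f [1..<Suc m]"
  have set_fs: "set fs = f ` {1..m}"
    by (simp only: fs_def set_map set_upt atLeastLessThanSuc_atLeastAtMost)
  define p where "p = capelli ?y (m - 1) fs"
  define \<beta> where "\<beta> = (\<Sum>j = 1..m. nc_deg (f j)) + m - 1"
  have "p \<noteq> 0"
    unfolding p_def
  proof (rule capelli_nonzero)
    show "independent_list fs"
      unfolding fs_def using indep by (rule independent_list_if_not_lin_dependent) simp_all
    show "length fs = Suc (m - 1)"
      using assms(2) by (simp add: fs_def del: upt_Suc)
    show "\<forall>g\<in>set fs. \<forall>w\<in>Poly_Mapping.keys g. Suc n \<notin> set w"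
      using assms(4) unfolding set_fs free_algebra_def by fastforce
  qed
  moreover have "p \<in> free_algebra (Suc n)"
    unfolding p_def
  proof (rule capelli_free_algebra)
    show "?y \<in> free_algebra (Suc n)"
      by (rule free_algebra_single) simp
    show "set fs \<subseteq> free_algebra (Suc n)"
      using assms(4) free_algebra_mono [of n "Suc n"] unfolding set_fs by auto
  qed
  moreover have "nc_eval scale p a = 0" for a
  proof -
    have "lin_dependent scale m (\<lambda>j. nc_eval scale (f j) a)"
      using assms(5) by (simp add: locally_lin_dependent_def)
    then have "capelli (nc_eval scale ?y a) (m - 1) (map (\<lambda>j. nc_eval scale (f j) a) [1..<Suc m]) = 0"
      by (rule capelli_eq_0_if_dependent)
    then show ?thesis
      by (simp add: p_def fs_def nc_eval_capelli comp_def del: upt_Suc)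
  qed
  ultimately have identity: "polynomial_identity scale p"
    by (auto simp: polynomial_identity_def)
  have "sum_list (map nc_deg fs) = (\<Sum>j = 1..m. nc_deg (f j))"
    unfolding fs_def map_map comp_def
    by (simp only: interv_sum_list_conv_sum_set_nat set_upt atLeastLessThanSuc_atLeastAtMost)
  then have "nc_deg p \<le> \<beta>"
    using nc_deg_capelli_le [of "Suc n" "m - 1" fs] assms(2)
    by (simp add: p_def \<beta>_def)
  \<comment> \<open>Leading terms may have cancelled in \<open>p\<close>; the monomial makes up for the lost degree.\<close>
  define q where "q = p * Poly_Mapping.single (replicate (\<beta> - nc_deg p) 1) 1"
  have "nc_deg q = \<beta>"
    using mult_monomial_right(2) [OF \<open>p \<noteq> 0\<close>] \<open>nc_deg p \<le> \<beta>\<close> by (simp add: q_def)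
  moreover have "polynomial_identity scale q"
    unfolding q_def using identity by (rule polynomial_identity_mult_monomial)
  ultimately show False
    using assms(6) unfolding \<beta>_def by blast
qed

end
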